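(* In the secretary problem with values in $[0,1]$ and regret minimization as the objective, no (possibly randomized) online algorithm achieves worst-case regret less than $0.152$.
   Context: Secretary problem: an adversary fixes $n$ values $1\ge x_1\ge\dots\ge x_n\ge 0$, which arrive in a uniformly random order (equivalently, $x_i$ arrives at an independent uniform time $t_i\in[0,1]$). An online algorithm observes the values one at a time, irrevocably decides whether to pick each, picks at most one, and obtains $0$ if it picks none. Its regret is $\sup_{\vec x}(x_1-\mathbb{E}[\mathsf{Alg}(\vec x)])$, the supremum over all $n$ and all value vectors. *)

theory Defs
  imports "HOL-Probability.Probability" "HOL-Combinatorics.Multiset_Permutations"
begin

text \<open>A stopping rule is told the number of values and the list of values seen so far in order of
  arrival, the current one last, and says whether to pick the current value. A randomized algorithm
  is a stopping rule that depends on a random seed drawn from an arbitrary probability space,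
  independently of the arrival order. Arrival times would give it nothing more: the sorted arrival
  times are independent of the arrival order, so they may be taken to be part of the seed.\<close>

type_synonym stopping_rule = "nat \<Rightarrow> real list \<Rightarrow> bool"

definition randomized_online_algorithm :: "'w measure \<Rightarrow> ('w \<Rightarrow> stopping_rule) \<Rightarrow> bool" where
  "randomized_online_algorithm M alg \<longleftrightarrow>
     prob_space M \<and> (\<forall>n h. {\<omega> \<in> space M. alg \<omega> n h} \<in> sets M)"

text \<open>In \<open>picked r h vs\<close> the values \<open>h\<close> have been rejected already and \<open>vs\<close> are still to come.\<close>

primrec picked :: "(real list \<Rightarrow> bool) \<Rightarrow> real list \<Rightarrow> real list \<Rightarrow> real" where
  "picked r h [] = 0"
| "picked r h (v # vs) = (if r (h @ [v]) then v else picked r (h @ [v]) vs)"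

text \<open>An arrival order is a list \<open>\<sigma>\<close> that enumerates the indices \<open>{1..n}\<close> without repetition.\<close>

definition expected_value ::
    "'w measure \<Rightarrow> ('w \<Rightarrow> stopping_rule) \<Rightarrow> nat \<Rightarrow> (nat \<Rightarrow> real) \<Rightarrow> real" where
  "expected_value M alg n x =
     measure_pmf.expectation (pmf_of_set (permutations_of_set {1..n}))
       (\<lambda>\<sigma>. \<integral>\<omega>. picked (alg \<omega> n) [] (map x \<sigma>) \<partial>M)"

definition instances :: "(nat \<times> (nat \<Rightarrow> real)) set" where
  "instances = {(n, x). 1 \<le> n \<and> antimono_on {1..n} x \<and> (\<forall>i\<in>{1..n}. 0 \<le> x i \<and> x i \<le> 1)}"

text \<open>The supremum is over a nonempty set of reals bounded above by \<open>1\<close>.\<close>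

definition worst_case_regret :: "'w measure \<Rightarrow> ('w \<Rightarrow> stopping_rule) \<Rightarrow> real" where
  "worst_case_regret M alg = (SUP (n, x) \<in> instances. x 1 - expected_value M alg n x)"

end

(* By averaging, it suffices to exhibit a prior on instances against which every deterministic
   stopping rule has expected regret at least 0.152. The prior has n = 30 values: a few distinct
   ones among 1/3, 1/2, 2/3, 1, and zeros elsewhere. Mostly the set of nonzero values is a chain
   {1/3}, {1/3,1/2}, {1/3,1/2,2/3}, {1/3,1/2,2/3,1}, so that whoever sees an intermediate value does
   not know whether a larger one is still to come. The weights come from a numerical solution of the
   zero-sum game, rounded to integers; the rounded prior gives regret 0.15218. The best response of
   the algorithm is bounded by backward induction over the number of remaining values and the set of
   nonzero values seen, which are all that matters for the conditional distribution. *)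

theory Submission
  imports Defs
begin

section \<open>Weighted sums over value sequences\<close>

text \<open>The sum of \<open>f\<close> over the continuations of length \<open>n\<close> of a sequence whose set of nonzero entries
  is \<open>S\<close>; nonzero entries lie in \<open>D\<close> and do not repeat, and a sequence whose nonzero entries
  form the set \<open>T\<close> has weight \<open>w T\<close>. Then \<open>mass\<close> is the total weight of the continuations, and
  \<open>opt\<close> is the value of optimal stopping, where the reward is not normalized by \<open>mass\<close>.\<close>

primrec wsum :: "nat set \<Rightarrow> (nat set \<Rightarrow> real) \<Rightarrow> nat \<Rightarrow> nat set \<Rightarrow> (nat list \<Rightarrow> real) \<Rightarrow> real" where
  "wsum D w 0 S f = w S * f []"
| "wsum D w (Suc n) S f =
     wsum D w n S (\<lambda>l. f (0 # l)) + (\<Sum>v\<in>D - S. wsum D w n (insert v S) (\<lambda>l. f (v # l)))"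

primrec mass :: "nat set \<Rightarrow> (nat set \<Rightarrow> int) \<Rightarrow> nat \<Rightarrow> nat set \<Rightarrow> int" where
  "mass D w 0 S = w S"
| "mass D w (Suc n) S = mass D w n S + (\<Sum>v\<in>D - S. mass D w n (insert v S))"

primrec opt :: "nat set \<Rightarrow> (nat set \<Rightarrow> int) \<Rightarrow> nat \<Rightarrow> nat set \<Rightarrow> int" where
  "opt D w 0 S = 0"
| "opt D w (Suc n) S = opt D w n S +
     (\<Sum>v\<in>D - S. max (int v * mass D w n (insert v S)) (opt D w n (insert v S)))"

lemma wsum_0: "wsum D (\<lambda>S. 0) n S f = 0"
  by (induction n arbitrary: S f) simp_all

lemma wsum_add_weight:
  "wsum D (\<lambda>S. a * u S + w S) n S f = a * wsum D u n S f + wsum D w n S f"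
  by (induction n arbitrary: S f) (simp_all add: algebra_simps sum.distrib sum_distrib_left)

lemma wsum_const: "wsum D (\<lambda>S. real_of_int (w S)) n S (\<lambda>l. c) = c * real_of_int (mass D w n S)"
  by (induction n arbitrary: S) (simp_all add: algebra_simps sum_distrib_left)

text \<open>Each step adds at most one level and removes none, so \<open>n\<close> steps cannot turn
  \<open>S\<close> into \<open>T\<close>.\<close>

lemma wsum_indicator_eq_0:
  assumes "\<not> (S \<subseteq> T \<and> card (T - S) \<le> n)"
  shows "wsum D (\<lambda>S. of_bool (S = T)) n S f = 0"
  using assms
proof (induction n arbitrary: S f)
  case 0
  then show ?case by auto
next
  case (Suc n)
  have "wsum D (\<lambda>S. of_bool (S = T)) n (insert v S) g = 0" if "v \<in> D - S" for v g
  proof (rule Suc.IH)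
    show "\<not> (insert v S \<subseteq> T \<and> card (T - insert v S) \<le> n)"
    proof
      assume *: "insert v S \<subseteq> T \<and> card (T - insert v S) \<le> n"
      have "card (T - S) \<le> Suc (card (T - S - {v}))"
        by (metis card_Suc_Diff1 card.infinite Diff_empty Diff_insert0 le_SucI order.refl zero_le)
      then show False using * Suc.prems by (auto simp: Diff_insert[of T v S])
    qed
  qed
  moreover have "wsum D (\<lambda>S. of_bool (S = T)) n S g = 0" for g
    using Suc.prems by (intro Suc.IH) auto
  ultimately show ?case by simp
qed

section \<open>From arrival orders to value sequences\<close>

lemma sum_permutations_of_set:
  assumes "finite A" "A \<noteq> {}"
  shows "(\<Sum>\<sigma>\<in>permutations_of_set A. f \<sigma>) =
    (\<Sum>a\<in>A. \<Sum>\<sigma>\<in>permutations_of_set (A - {a}). f (a # \<sigma>))"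
proof -
  have "(\<Sum>\<sigma>\<in>permutations_of_set A. f \<sigma>) =
      (\<Sum>a\<in>A. \<Sum>\<sigma>\<in>(#) a ` permutations_of_set (A - {a}). f \<sigma>)"
    unfolding permutations_of_set_nonempty[OF assms(2)]
    using assms(1) by (intro sum.UNION_disjoint) auto
  also have "\<dots> = (\<Sum>a\<in>A. \<Sum>\<sigma>\<in>permutations_of_set (A - {a}). f (a # \<sigma>))"
    by (simp add: sum.reindex)
  finally show ?thesis .
qed

text \<open>Only the zeros are interchangeable, so each value sequence comes from as many arrival
  orders as there are permutations of the zero indices. \<open>S\<close> holds the levels already
  seen, \<open>T - S\<close> those still to arrive.\<close>

lemma sum_permutations_eq_wsum:
  fixes y :: "'a \<Rightarrow> nat"
  assumes "finite A" "finite D" "S \<subseteq> T" "T \<subseteq> D" "0 \<notin> D"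
    and "bij_betw y {a\<in>A. y a \<noteq> 0} (T - S)"
  shows "(\<Sum>\<sigma>\<in>permutations_of_set A. f (map y \<sigma>)) =
    fact (card {a\<in>A. y a = 0}) * wsum D (\<lambda>S. of_bool (S = T)) (card A) S f"
  using assms
proof (induction "card A" arbitrary: A S f)
  case 0
  then have "A = {}" by simp
  moreover from this have "S = T" using 0 by (auto simp: bij_betw_def)
  ultimately show ?case by simp
next
  case (Suc n)
  let ?Z = "{a\<in>A. y a = 0}" and ?N = "{a\<in>A. y a \<noteq> 0}"
  let ?I = "\<lambda>S. of_bool (S = T) :: real"
  have A: "A \<noteq> {}" "finite A" "A = ?Z \<union> ?N" "?Z \<inter> ?N = {}" using Suc.hyps(2) Suc.prems(1) by auto
  have card: "card (A - {a}) = n" if "a \<in> A" for a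
    using that Suc.hyps(2) by simp
  have zero: "(\<Sum>\<sigma>\<in>permutations_of_set (A - {a}). f (map y (a # \<sigma>))) =
      fact (card ?Z - 1) * wsum D ?I n S (\<lambda>l. f (0 # l))" if a: "a \<in> ?Z" for a
  proof -
    have *: "{b \<in> A - {a}. y b \<noteq> 0} = ?N" "{b \<in> A - {a}. y b = 0} = ?Z - {a}"
      using a by auto
    show ?thesis
      using Suc.hyps(1)[OF card[symmetric], of a S "\<lambda>l. f (0 # l)", unfolded *] Suc.prems card[of a] a
      by simp
  qed
  have nonzero: "(\<Sum>\<sigma>\<in>permutations_of_set (A - {a}). f (map y (a # \<sigma>))) =
      fact (card ?Z) * wsum D ?I n (insert (y a) S) (\<lambda>l. f (y a # l))" if a: "a \<in> ?N" for a
  proof -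
    have ya: "y a \<in> T - S" using a Suc.prems(6) by (auto simp: bij_betw_def)
    have *: "{b \<in> A - {a}. y b \<noteq> 0} = ?N - {a}" "{b \<in> A - {a}. y b = 0} = ?Z"
      using a by auto
    have "bij_betw y (?N - {a}) (T - insert (y a) S)"
      unfolding Diff_insert[of T "y a" S] using a ya by (intro bij_betw_DiffI[OF Suc.prems(6)]) simp_all
    then show ?thesis
      using Suc.hyps(1)[OF card[symmetric], of a "insert (y a) S" "\<lambda>l. f (y a # l)", unfolded *]
        Suc.prems(1-5) card[of a] a ya
      by (simp add: subset_iff)
  qed
  \<comment> \<open>Without zeros, \<open>card ?Z - 1\<close> truncates to 0, but both sides vanish:
    \<open>n\<close> steps cannot supply the \<open>Suc n\<close> missing levels.\<close>
  have Zsum: "real (card ?Z) * fact (card ?Z - 1) * wsum D ?I n S g = fact (card ?Z) * wsum D ?I n S g" for g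
  proof (cases "card ?Z")
    case 0
    then have "?N = A" using A by auto
    then have "card (T - S) = Suc n" using Suc.prems(6) Suc.hyps(2) by (simp add: bij_betw_same_card)
    then show ?thesis by (simp add: wsum_indicator_eq_0)
  qed simp
  have Nsum: "(\<Sum>a\<in>?N. g (y a)) = (\<Sum>v\<in>T - S. g v)" for g :: "nat \<Rightarrow> real"
    by (rule sum.reindex_bij_betw[OF Suc.prems(6)])
  have split: "sum g A = sum g ?Z + sum g ?N" for g :: "'a \<Rightarrow> real"
    using sum.union_disjoint[of ?Z ?N g] A by simp
  have "(\<Sum>\<sigma>\<in>permutations_of_set A. f (map y \<sigma>)) =
      (\<Sum>a\<in>?Z. \<Sum>\<sigma>\<in>permutations_of_set (A - {a}). f (map y (a # \<sigma>))) +
      (\<Sum>a\<in>?N. \<Sum>\<sigma>\<in>permutations_of_set (A - {a}). f (map y (a # \<sigma>)))"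
    unfolding sum_permutations_of_set[OF A(2,1)] by (rule split)
  also have "\<dots> = fact (card ?Z) * wsum D ?I n S (\<lambda>l. f (0 # l)) +
      (\<Sum>v\<in>T - S. fact (card ?Z) * wsum D ?I n (insert v S) (\<lambda>l. f (v # l)))"
    using Zsum Nsum[of "\<lambda>v. fact (card ?Z) * wsum D ?I n (insert v S) (\<lambda>l. f (v # l))"]
    by (simp only: zero nonzero sum_constant cong: sum.cong) (simp add: mult.assoc)
  also have "(\<Sum>v\<in>T - S. fact (card ?Z) * wsum D ?I n (insert v S) (\<lambda>l. f (v # l))) =
      (\<Sum>v\<in>D - S. fact (card ?Z) * wsum D ?I n (insert v S) (\<lambda>l. f (v # l)))"
  proof (intro sum.mono_neutral_left ballI)
    fix v
    assume "v \<in> D - S - (T - S)"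
    then show "fact (card ?Z) * wsum D ?I n (insert v S) (\<lambda>l. f (v # l)) = 0"
      by (subst wsum_indicator_eq_0) auto
  qed (use Suc.prems(2,4) in auto)
  finally show ?case
    by (simp add: Suc.hyps(2)[symmetric] sum_distrib_left distrib_left)
qed

section \<open>Backward induction\<close>

lemma mass_nonneg:
  assumes "\<And>S. 0 \<le> w S"
  shows "0 \<le> mass D w n S"
  by (induction n arbitrary: S) (auto simp: assms intro!: add_nonneg_nonneg sum_nonneg)

lemma opt_nonneg:
  assumes "\<And>S. 0 \<le> w S"
  shows "0 \<le> opt D w n S"
  by (induction n arbitrary: S)
    (auto intro!: add_nonneg_nonneg sum_nonneg simp: le_max_iff_disj)

text \<open>No pick earns more than the top level. This later shows that taking the top level at
  sight is optimal.\<close>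

lemma opt_le_mass:
  assumes "\<And>S. 0 \<le> w S" and "\<And>v. v \<in> D \<Longrightarrow> v \<le> c"
  shows "opt D w n S \<le> int c * mass D w n S"
proof (induction n arbitrary: S)
  case 0
  then show ?case by (simp add: assms)
next
  case (Suc n)
  have "max (int v * mass D w n (insert v S)) (opt D w n (insert v S))
      \<le> int c * mass D w n (insert v S)" if "v \<in> D - S" for v
    using Suc.IH assms(2) that by (auto intro!: mult_right_mono mass_nonneg assms(1))
  then show ?case
    using Suc.IH by (auto simp: distrib_left sum_distrib_left intro!: add_mono sum_mono)
qed

text \<open>The history \<open>h\<close> need not be tied to \<open>S\<close>: whatever the rule has
  seen, the weight of the continuations depends only on \<open>S\<close>. Picking \<open>v\<close>
  earns \<open>v / c\<close> times the mass behind it; rejecting is covered by the induction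
  hypothesis.\<close>

lemma wsum_picked_le_opt:
  fixes c :: nat
  assumes "c > 0" and "\<And>S. 0 \<le> w S"
  shows "wsum D (\<lambda>S. real_of_int (w S)) n S (\<lambda>l. picked r h (map (\<lambda>v. real v / c) l))
    \<le> real_of_int (opt D w n S) / c"
proof (induction n arbitrary: S h)
  case 0
  then show ?case by simp
next
  case (Suc n)
  let ?w = "\<lambda>S. real_of_int (w S)" and ?g = "\<lambda>v. real v / c"
  \<comment> \<open>Picking a zero earns 0, which is no better than continuing.\<close>
  have "wsum D ?w n S (\<lambda>l. picked r h (map ?g (0 # l))) \<le> real_of_int (opt D w n S) / c"
    using Suc.IH[of S "h @ [0]"] opt_nonneg[OF assms(2)]
    by (cases "r (h @ [0])") (simp_all add: wsum_const)
  moreover have "wsum D ?w n (insert v S) (\<lambda>l. picked r h (map ?g (v # l))) \<le>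
      real_of_int (max (int v * mass D w n (insert v S)) (opt D w n (insert v S))) / c"
    (is "_ \<le> real_of_int (max ?a ?b) / c") for v
  proof -
    have "real_of_int ?a / c \<le> real_of_int (max ?a ?b) / c" "real_of_int ?b / c \<le> real_of_int (max ?a ?b) / c"
      by (intro divide_right_mono; simp only: of_int_le_iff max.cobounded1 max.cobounded2 of_nat_0_le_iff)+
    then show ?thesis
      using Suc.IH[of "insert v S" "h @ [?g v]"]
      by (cases "r (h @ [?g v])") (simp_all add: wsum_const)
  qed
  ultimately show ?case
    by (auto simp: add_divide_distrib sum_divide_distrib intro!: add_mono sum_mono)
qed

section \<open>Averaging over the random seed\<close>

lemma wsum_integral:
  assumes "\<And>l. integrable M (\<lambda>\<omega>. F \<omega> l)"
  shows "integrable M (\<lambda>\<omega>. wsum D w n S (F \<omega>)) \<and>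
    (\<integral>\<omega>. wsum D w n S (F \<omega>) \<partial>M) = wsum D w n S (\<lambda>l. \<integral>\<omega>. F \<omega> l \<partial>M)"
  using assms
proof (induction n arbitrary: S F)
  case (Suc n)
  show ?case
    using Suc.IH[of "\<lambda>\<omega> l. F \<omega> (0 # l)" S] Suc.IH[of "\<lambda>\<omega> l. F \<omega> (_ # l)"] Suc.prems
    by (simp add: Bochner_Integration.integral_add Bochner_Integration.integral_sum)
qed simp

lemma wsum_sum_list:
  "wsum D (\<lambda>S. \<Sum>(a, ls)\<leftarrow>xs. a * of_bool (S = set ls)) n S f =
    (\<Sum>(a, ls)\<leftarrow>xs. a * wsum D (\<lambda>S. of_bool (S = set ls)) n S f)"
  by (induction xs) (auto simp: wsum_0 wsum_add_weight split_def)

lemma picked_in_set: "picked r h vs \<in> insert 0 (set vs)"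
  by (induction vs arbitrary: h) auto

lemma borel_measurable_picked:
  assumes "randomized_online_algorithm M alg"
  shows "(\<lambda>\<omega>. picked (alg \<omega> n) h vs) \<in> borel_measurable M"
proof (induction vs arbitrary: h)
  case (Cons v vs)
  have "{\<omega> \<in> space M. alg \<omega> n (h @ [v])} \<in> sets M"
    using assms by (simp add: randomized_online_algorithm_def)
  then show ?case
    using Cons by (auto intro!: measurable_If)
qed simp

lemma integrable_picked:
  assumes "randomized_online_algorithm M alg"
  shows "integrable M (\<lambda>\<omega>. picked (alg \<omega> n) h vs)"
proof -
  interpret prob_space M
    using assms by (simp add: randomized_online_algorithm_def)
  have "\<bar>picked r h vs\<bar> \<le> (\<Sum>v\<in>set vs. \<bar>v\<bar>)" for r
    using picked_in_set[of r h vs] member_le_sum[of "picked r h vs" "set vs" abs]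
    by (auto intro: sum_nonneg)
  then show ?thesis
    using borel_measurable_picked[OF assms] by (intro integrable_const_bound[where B = "\<Sum>v\<in>set vs. \<bar>v\<bar>"]) auto
qed

section \<open>Instances with few nonzero values\<close>

definition padded :: "nat list \<Rightarrow> nat \<Rightarrow> nat" where
  "padded ls i = (if 1 \<le> i \<and> i \<le> length ls then ls ! (i - 1) else 0)"

lemma bij_betw_padded:
  assumes "distinct ls" "0 \<notin> set ls" "length ls \<le> n"
  shows "bij_betw (padded ls) {i\<in>{1..n}. padded ls i \<noteq> 0} (set ls)"
proof -
  have *: "padded ls i \<noteq> 0 \<longleftrightarrow> i \<in> {1..length ls}" for i
  proof (cases "1 \<le> i \<and> i \<le> length ls")
    case True
    then have "ls ! (i - 1) \<in> set ls" by (intro nth_mem) auto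
    then show ?thesis using assms(2) True by (metis atLeastAtMost_iff padded_def)
  qed (auto simp: padded_def)
  have nz: "{i\<in>{1..n}. padded ls i \<noteq> 0} = {1..length ls}"
    unfolding * using assms(3) by auto
  have "bij_betw (\<lambda>i. i - 1) {1..length ls} {..<length ls}"
    by (rule bij_betw_byWitness[where f' = Suc]) auto
  from bij_betw_trans[OF this bij_betw_nth[OF assms(1) refl refl]]
  have "bij_betw ((!) ls \<circ> (\<lambda>i. i - 1)) {1..length ls} (set ls)" .
  then have "bij_betw (padded ls) {1..length ls} (set ls)"
    by (rule bij_betw_cong[THEN iffD1, rotated]) (auto simp: padded_def)
  then show ?thesis by (simp only: nz)
qed

lemma padded_instance:
  assumes "sorted_wrt (>) ls" "set ls \<subseteq> {..c}" "c > 0" "n \<ge> 1"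
  shows "(n, \<lambda>i. real (padded ls i) / real c) \<in> instances"
proof -
  have "padded ls j \<le> padded ls i" if "1 \<le> i" "i \<le> j" for i j
    using that assms(1) by (cases "i = j") (auto simp: padded_def sorted_wrt_iff_nth_less intro!: less_imp_le)
  moreover have "padded ls i \<le> c" for i
  proof (cases "1 \<le> i \<and> i \<le> length ls")
    case True
    then have "ls ! (i - 1) \<in> set ls" by (intro nth_mem) auto
    then show ?thesis using assms(2) True by (auto simp: padded_def)
  qed (auto simp: padded_def)
  ultimately show ?thesis
    using assms(3,4) by (auto simp: instances_def monotone_on_def divide_right_mono divide_le_eq_1)
qed

text \<open>\<open>fact n\<close> counts the arrival orders, \<open>fact (n - length ls)\<close>
  those that differ only in the order of the zeros.\<close>

lemma expected_value_padded:
  assumes "sorted_wrt (>) ls" "length ls \<le> n" "set ls \<subseteq> D" "0 \<notin> D" "finite D"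
  shows "fact n * expected_value M alg n (\<lambda>i. real (padded ls i) / c) =
    fact (n - length ls) * wsum D (\<lambda>S. of_bool (S = set ls)) n {}
      (\<lambda>l. \<integral>\<omega>. picked (alg \<omega> n) [] (map (\<lambda>v. real v / c) l) \<partial>M)"
proof -
  let ?\<phi> = "\<lambda>l. \<integral>\<omega>. picked (alg \<omega> n) [] (map (\<lambda>v. real v / c) l) \<partial>M"
  have dist: "distinct ls"
    using assms(1) by (auto simp: distinct_conv_nth sorted_wrt_iff_nth_less) (metis less_irrefl linorder_neqE_nat)
  have bij: "bij_betw (padded ls) {i\<in>{1..n}. padded ls i \<noteq> 0} (set ls - {})"
    using bij_betw_padded[OF dist _ assms(2)] assms(3,4) by auto
  have "card {i\<in>{1..n}. padded ls i \<noteq> 0} = length ls"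
    using bij_betw_same_card[OF bij] dist by (simp add: distinct_card)
  moreover have "{i\<in>{1..n}. padded ls i = 0} = {1..n} - {i\<in>{1..n}. padded ls i \<noteq> 0}" by auto
  moreover have "card ({1..n} - {i\<in>{1..n}. padded ls i \<noteq> 0}) = card {1..n} - card {i\<in>{1..n}. padded ls i \<noteq> 0}"
    by (rule card_Diff_subset) auto
  ultimately have zeros: "card {i\<in>{1..n}. padded ls i = 0} = n - length ls"
    by (simp only: card_atLeastAtMost diff_Suc_1)
  have "fact n * expected_value M alg n (\<lambda>i. real (padded ls i) / c) =
      (\<Sum>\<sigma>\<in>permutations_of_set {1..n}. ?\<phi> (map (padded ls) \<sigma>))"
    by (simp add: expected_value_def integral_pmf_of_set comp_def)
  also have "\<dots> = fact (card {i\<in>{1..n}. padded ls i = 0}) *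
      wsum D (\<lambda>S. of_bool (S = set ls)) (card {1..n}) {} ?\<phi>"
    by (rule sum_permutations_eq_wsum) (use assms bij in auto)
  finally show ?thesis unfolding zeros by simp
qed

section \<open>From a prior to the worst case\<close>

lemma regret_le_worst_case:
  assumes "randomized_online_algorithm M alg" "(n, x) \<in> instances"
  shows "x 1 - expected_value M alg n x \<le> worst_case_regret M alg"
proof -
  have nonneg: "0 \<le> expected_value M alg n x" if "(n, x) \<in> instances" for n x
  proof -
    have "0 \<le> picked r [] (map x \<sigma>)" if \<sigma>: "\<sigma> \<in> permutations_of_set {1..n}" for r \<sigma>
      using picked_in_set[of r "[]" "map x \<sigma>"] \<open>(n, x) \<in> instances\<close> \<sigma>
      by (auto simp: instances_def permutations_of_set_def)
    then show ?thesis
      unfolding expected_value_def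
      by (subst integral_pmf_of_set) (auto intro!: sum_nonneg divide_nonneg_nonneg)
  qed
  have "x 1 - expected_value M alg n x \<le> 1" if "(n, x) \<in> instances" for n x
  proof -
    have "x 1 \<le> 1" using that by (auto simp: instances_def)
    then show ?thesis using nonneg[OF that] by linarith
  qed
  \<comment> \<open>Boundedness makes the real supremum an upper bound.\<close>
  then have "bdd_above ((\<lambda>(n, x). x 1 - expected_value M alg n x) ` instances)"
    by (intro bdd_aboveI2[where M = 1]) (simp only: split_paired_all prod.case)
  from cSUP_upper[OF assms(2) this] show ?thesis
    by (simp only: worst_case_regret_def prod.case)
qed

text \<open>Averaging over a prior: \<open>fact n / fact (n - length ls)\<close> sequences have the
  nonzero set \<open>set ls\<close>, so \<open>a\<close> times this number is the unnormalized
  probability of an instance with maximum \<open>hd ls / c\<close>.\<close>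

lemma worst_case_regret_bound:
  fixes xs :: "(nat \<times> nat list) list" and w :: "nat set \<Rightarrow> int"
  assumes alg: "randomized_online_algorithm M alg"
    and xs: "\<And>a ls. (a, ls) \<in> set xs \<Longrightarrow> sorted_wrt (>) ls \<and> ls \<noteq> [] \<and> length ls \<le> n \<and> set ls \<subseteq> D"
    and D: "D \<subseteq> {1..c}" and "c > 0"
    and w: "w = (\<lambda>S. \<Sum>(a, ls)\<leftarrow>xs. int a * of_bool (S = set ls))"
  shows "(\<Sum>(a, ls)\<leftarrow>xs. real a * (fact n / fact (n - length ls)) * (real (hd ls) / c - worst_case_regret M alg))
    \<le> real_of_int (opt D w n {}) / c"
proof -
  interpret prob_space M
    using alg by (simp add: randomized_online_algorithm_def)
  let ?g = "\<lambda>v. real v / real c" and ?R = "worst_case_regret M alg"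
  let ?\<phi> = "\<lambda>l. \<integral>\<omega>. picked (alg \<omega> n) [] (map ?g l) \<partial>M"
  have [simp]: "finite D" using D by (rule finite_subset) simp
  have w_nonneg: "0 \<le> w S" for S
    unfolding w by (intro sum_list_nonneg) auto
  have w_real: "(\<lambda>S. real_of_int (w S)) = (\<lambda>S. \<Sum>(a, ls)\<leftarrow>map (map_prod real id) xs. a * of_bool (S = set ls))"
    unfolding w by (rule ext, induction xs) auto
  have term_le: "real a * (fact n / fact (n - length ls)) * (real (hd ls) / c - ?R)
      \<le> real a * wsum D (\<lambda>S. of_bool (S = set ls)) n {} ?\<phi>" if "(a, ls) \<in> set xs" for a ls
  proof -
    let ?x = "\<lambda>i. real (padded ls i) / real c"
    have ls: "sorted_wrt (>) ls" "ls \<noteq> []" "length ls \<le> n" "set ls \<subseteq> D"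
      using xs[OF that] by auto
    have "n \<ge> 1" using ls(2,3) by (cases ls) auto
    moreover have "set ls \<subseteq> {..c}" using ls(4) D by auto
    ultimately have "?x 1 - expected_value M alg n ?x \<le> ?R"
      using padded_instance[OF ls(1)] \<open>c > 0\<close> by (intro regret_le_worst_case alg) auto
    moreover have "?x 1 = real (hd ls) / c"
      using ls(2) by (simp add: padded_def hd_conv_nth Suc_le_eq)
    ultimately have "real (hd ls) / c - ?R \<le> expected_value M alg n ?x" by argo
    then have "real a * (fact n / fact (n - length ls)) * (real (hd ls) / c - ?R) \<le>
        real a * (fact n / fact (n - length ls)) * expected_value M alg n ?x"
      by (intro mult_left_mono) auto
    also have "\<dots> = real a * (fact n * expected_value M alg n ?x / fact (n - length ls))"
      by simp
    also have "fact n * expected_value M alg n ?x / fact (n - length ls) =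
        wsum D (\<lambda>S. of_bool (S = set ls)) n {} ?\<phi>"
      using D by (subst expected_value_padded[of _ _ D]) (use ls in auto)
    finally show ?thesis .
  qed
  have "(\<Sum>(a, ls)\<leftarrow>xs. real a * (fact n / fact (n - length ls)) * (real (hd ls) / c - ?R)) \<le>
      (\<Sum>(a, ls)\<leftarrow>xs. real a * wsum D (\<lambda>S. of_bool (S = set ls)) n {} ?\<phi>)"
    by (rule sum_list_mono, simp only: split_def, rule term_le, simp)
  also have "\<dots> = wsum D (\<lambda>S. real_of_int (w S)) n {} ?\<phi>"
    unfolding w_real wsum_sum_list by (simp add: comp_def split_def)
  \<comment> \<open>With the integral outermost, the seed is fixed inside it and the bound for
    deterministic rules applies pointwise.\<close>
  also have "\<dots> = (\<integral>\<omega>. wsum D (\<lambda>S. real_of_int (w S)) n {} (\<lambda>l. picked (alg \<omega> n) [] (map ?g l)) \<partial>M)"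
    using wsum_integral[OF integrable_picked[OF alg]] by simp
  also have "\<dots> \<le> real_of_int (opt D w n {}) / c"
    using wsum_integral[OF integrable_picked[OF alg]] wsum_picked_le_opt[OF \<open>c > 0\<close> w_nonneg]
    by (intro integral_le_const) auto
  finally show ?thesis .
qed

section \<open>The hard prior and its optimal value\<close>

text \<open>Level \<open>v\<close> stands for the value \<open>v / 6\<close>. The weight is the one of each single sequence of length
  \<open>30\<close>, so that the six sets have probabilities of about 0.43, 0.16, 0.15, 0.05, 0.18 and 0.04.\<close>

definition hard :: "(nat \<times> nat list) list" where
  "hard = [(1, [6, 4, 3, 2]), (10, [4, 3, 2]), (270, [3, 2]), (80, [4, 2]), (9000, [2]), (2000, [3])]"

definition hard_weight :: "nat set \<Rightarrow> int" where
  "hard_weight = (\<lambda>S. \<Sum>(a, ls)\<leftarrow>hard. int a * of_bool (S = set ls))"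

abbreviation levels :: "nat set" where "levels \<equiv> {2, 3, 4, 6}"
abbreviation "hmass \<equiv> mass levels hard_weight"
abbreviation "hopt \<equiv> opt levels hard_weight"

text \<open>One step of the recursions of \<open>mass\<close> and \<open>opt\<close>: \<open>m\<close> and \<open>v\<close> stand for the mass and the optimal
  value after the levels in the index, and \<open>ki\<close> for the mass after any \<open>i\<close> levels that include
  \<open>6\<close>. Taking level \<open>6\<close> is always best, so no optimal values are needed after it.\<close>

fun step where
  "step (m2, m3, m4, m23, m24, m34, m234, k1, k2, k3, v, v2, v3, v4, v23, v24, v34, v234) =
     (m2 + m23 + m24 + k2, m3 + m23 + m34 + k2, m4 + m24 + m34 + k2,
      m23 + m234 + k3, m24 + m234 + k3, m34 + m234 + k3, m234 + 1,
      k1 + 3 * k2, k2 + 2 * k3, k3 + (1 :: int),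
      v + max (2 * m2) v2 + max (3 * m3) v3 + max (4 * m4) v4 + 6 * k1,
      v2 + max (3 * m23) v23 + max (4 * m24) v24 + 6 * k2,
      v3 + max (2 * m23) v23 + max (4 * m34) v34 + 6 * k2,
      v4 + max (2 * m24) v24 + max (3 * m34) v34 + 6 * k2,
      v23 + max (4 * m234) v234 + 6 * k3,
      v24 + max (3 * m234) v234 + 6 * k3,
      v34 + max (2 * m234) v234 + 6 * k3,
      v234 + (6 :: int))"

primrec row where
  "row 0 = (9000, 2000, 0, 270, 80, 0, 10, 0, 0, 0, 0, 0, 0, 0, 0, 0, 0, 0)"
| "row (Suc n) = step (row n)"

lemma hard_weight_nonneg: "0 \<le> hard_weight S"
  unfolding hard_weight_def by (intro sum_list_nonneg) auto

text \<open>The only set of positive weight containing 6 is \<open>levels\<close>, so after 6 the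
  mass depends only on how many levels are missing.\<close>

lemma hmass_6:
  "hmass n levels = 1 \<and> hmass n {2, 4, 6} = hmass n {2, 3, 6} \<and> hmass n {3, 4, 6} = hmass n {2, 3, 6} \<and>
   hmass n {3, 6} = hmass n {2, 6} \<and> hmass n {4, 6} = hmass n {2, 6}"
proof (induction n)
  case 0
  then show ?case by (simp add: hard_weight_def hard_def set_eq_subset)
next
  case (Suc n)
  then show ?case by (simp add: insert_Diff_if insert_commute)
qed

lemma row_eq:
  "row n = (hmass n {2}, hmass n {3}, hmass n {4}, hmass n {2, 3}, hmass n {2, 4}, hmass n {3, 4},
     hmass n {2, 3, 4}, hmass n {6}, hmass n {2, 6}, hmass n {2, 3, 6},
     hopt n {}, hopt n {2}, hopt n {3}, hopt n {4}, hopt n {2, 3}, hopt n {2, 4}, hopt n {3, 4},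
     hopt n {2, 3, 4})"
proof (induction n)
  case 0
  then show ?case by (simp add: hard_weight_def hard_def set_eq_subset)
next
  case (Suc n)
  have "max (6 * hmass n S) (hopt n S) = 6 * hmass n S" for S
  proof -
    have "hopt n S \<le> int 6 * hmass n S"
      by (rule opt_le_mass) (auto simp: hard_weight_nonneg)
    then show ?thesis by simp
  qed
  then show ?case
    using Suc.IH by (simp add: insert_Diff_if insert_commute) (simp add: hmass_6)
qed

text \<open>Iterating \<open>row\<close> shares the results for all sets, whereas unfolding
  \<open>opt\<close> would branch at every step.\<close>

lemma opt_hard: "hopt 30 {} = 5221489"
proof -
  have "fst (snd (snd (snd (snd (snd (snd (snd (snd (snd (snd (row 30))))))))))) = 5221489"
    by code_simp
  then show ?thesis by (simp add: row_eq)
qed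

theorem theorem5p1:
  fixes M :: "'w measure" and alg :: "'w \<Rightarrow> stopping_rule"
  assumes "randomized_online_algorithm M alg"
  shows "\<not> worst_case_regret M alg < 0.152"
proof -
  have "(\<Sum>(a, ls)\<leftarrow>hard. real a * (fact 30 / fact (30 - length ls)) *
      (real (hd ls) / real 6 - worst_case_regret M alg)) \<le> real_of_int (hopt 30 {}) / real 6"
    by (rule worst_case_regret_bound[OF assms _ _ _ hard_weight_def]) (auto simp: hard_def)
  \<comment> \<open>With the factorials reduced to \<open>fact 26\<close>, the inequality is linear
    in the regret: total weight 1535820 gives at least (6623820 - 5221489) / (6 * 1535820) >
    0.152.\<close>
  moreover have "fact 30 = (657720 * fact 26 :: real)" "fact 29 = (21924 * fact 26 :: real)"
    "fact 28 = (756 * fact 26 :: real)" "fact 27 = (27 * fact 26 :: real)"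
    by (simp_all add: fact_numeral)
  ultimately show ?thesis
    by (simp add: opt_hard hard_def add_divide_distrib diff_divide_distrib)
qed

end
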